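(* $\mathcal{H}_{\mathrm{ferro}}\subsetneq\mathcal{SDP}$.
   Context: $\mathcal{B}_k$ is the set of functions $\{0,1\}^k\to\mathbb{R}_{\ge0}$, $\mathcal{B}=\bigcup_k\mathcal{B}_k$; $|\mathbf{x}|$ Hamming weight, $\overline{\mathbf{x}}$ complement. $\mathrm{EQ}$ is the binary equality indicator. $\langle\mathcal{F}\rangle$ is the closure of $\mathcal{F}\cup\{\mathrm{EQ}\}$ under introducing fictitious arguments, permuting arguments, pointwise product of equal-arity functions, and summing out an argument over $\{0,1\}$; a $k$-ary $f$ is a limit of $\mathcal{F}$ if there is a finite $S\subseteq\mathcal{F}$ such that for all $\epsilon>0$ some $k$-ary $f_\epsilon\in\langle S\rangle$ has $\max_\mathbf{x}|f-f_\epsilon|<\epsilon$; $\langle\mathcal{F}\rangle_\omega$ is the closure of $\mathcal{F}\cup\{\mathrm{EQ}\}$ under the four operations and limits. Fourier transform: $\widehat f(\mathbf{x})=2^{-k}\sum_{\mathbf{w}}(-1)^{|\mathbf{w}\wedge\mathbf{x}|}f(\mathbf{w})$. $\mathcal{SDP}$ is the set of $f\in\mathcal{B}$ such that $f(\mathbf{x})=f(\overline{\mathbf{x}})$ for all $\mathbf{x}$, $\widehat f(\mathbf{x})\ge0$ for all $\mathbf{x}$, and $\widehat f(\mathbf{x})\le 0$ for all $\mathbf{x}$ of odd weight (equivalently $\mathcal{SD}\cap\mathcal{P}\cap\mathcal{PN}$). $\mathrm{Ising}_k^\lambda\in\mathcal{B}_k$ ($\lambda\ge0$) is 1 on $\mathbf{0},\mathbf{1}$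 and $\lambda$ elsewhere, and $\mathcal{H}_{\mathrm{ferro}}=\langle\{\mathrm{Ising}_k^\lambda:k\ge2,0\le\lambda\le1\}\cup\mathcal{B}_0\rangle_\omega$. *)

theory Defs
  imports Complex_Main "HOL-Library.FuncSet" "HOL-Combinatorics.Permutations"
begin

definition cube :: "nat \<Rightarrow> bool list set" where
  "cube k = {x. length x = k}"

text \<open>
  A \<open>k\<close>-ary function is represented together with its arity, as a pair \<open>(k, f)\<close> where \<open>f\<close> is
  extensional on \<open>cube k\<close>. Equality of pairs is then equality of functions, and functions of
  different arity are always distinct.
\<close>

type_synonym bfun = "nat \<times> (bool list \<Rightarrow> real)"

definition Bk :: "nat \<Rightarrow> bfun set" where
  "Bk k = {k} \<times> (cube k \<rightarrow>\<^sub>E {0..})"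

definition BB :: "bfun set" where
  "BB = (\<Union>k. Bk k)"

definition weight :: "bool list \<Rightarrow> nat" where
  "weight x = count_list x True"

definition compl :: "bool list \<Rightarrow> bool list" where
  "compl x = map Not x"

definition meet :: "bool list \<Rightarrow> bool list \<Rightarrow> bool list" where
  "meet w x = map2 (\<and>) w x"

definition EQ :: bfun where
  "EQ = (2, \<lambda>x\<in>cube 2. if x ! 0 = x ! 1 then 1 else 0)"


text \<open>Argument positions are numbered from 0, and an argument may be added or summed out at any
  position.\<close>

definition insert_arg :: "nat \<Rightarrow> bool \<Rightarrow> bool list \<Rightarrow> bool list" where
  "insert_arg i b x = take i x @ b # drop i x"

definition delete_arg :: "nat \<Rightarrow> bool list \<Rightarrow> bool list" where
  "delete_arg i x = take i x @ drop (Suc i) x"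

definition fictitious :: "nat \<Rightarrow> nat \<Rightarrow> (bool list \<Rightarrow> real) \<Rightarrow> bool list \<Rightarrow> real" where
  "fictitious k i f = (\<lambda>x\<in>cube (Suc k). f (delete_arg i x))"

definition permute_args :: "nat \<Rightarrow> (nat \<Rightarrow> nat) \<Rightarrow> (bool list \<Rightarrow> real) \<Rightarrow> bool list \<Rightarrow> real" where
  "permute_args k \<pi> f = (\<lambda>x\<in>cube k. f (permute_list \<pi> x))"

definition pointwise_mult ::
    "nat \<Rightarrow> (bool list \<Rightarrow> real) \<Rightarrow> (bool list \<Rightarrow> real) \<Rightarrow> bool list \<Rightarrow> real" where
  "pointwise_mult k f g = (\<lambda>x\<in>cube k. f x * g x)"

definition sum_out :: "nat \<Rightarrow> nat \<Rightarrow> (bool list \<Rightarrow> real) \<Rightarrow> bool list \<Rightarrow> real" where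
  "sum_out k i f = (\<lambda>x\<in>cube k. \<Sum>b\<in>UNIV. f (insert_arg i b x))"

inductive_set clone :: "bfun set \<Rightarrow> bfun set" for F :: "bfun set" where
  base: "p \<in> F \<Longrightarrow> p \<in> clone F"
| eq: "EQ \<in> clone F"
| fict: "(k, f) \<in> clone F \<Longrightarrow> i \<le> k \<Longrightarrow> (Suc k, fictitious k i f) \<in> clone F"
| perm: "(k, f) \<in> clone F \<Longrightarrow> \<pi> permutes {..<k} \<Longrightarrow> (k, permute_args k \<pi> f) \<in> clone F"
| mult: "(k, f) \<in> clone F \<Longrightarrow> (k, g) \<in> clone F \<Longrightarrow> (k, pointwise_mult k f g) \<in> clone F"
| sum: "(Suc k, f) \<in> clone F \<Longrightarrow> i \<le> k \<Longrightarrow> (k, sum_out k i f) \<in> clone F"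

definition is_limit :: "bfun set \<Rightarrow> nat \<Rightarrow> (bool list \<Rightarrow> real) \<Rightarrow> bool" where
  "is_limit F k f \<longleftrightarrow> (k, f) \<in> Bk k \<and>
     (\<exists>S. finite S \<and> S \<subseteq> F \<and>
       (\<forall>\<epsilon>>0. \<exists>g. (k, g) \<in> clone S \<and> (MAX x\<in>cube k. \<bar>f x - g x\<bar>) < \<epsilon>))"

lemma is_limit_mono [mono]:
  assumes "\<And>p. P p \<longrightarrow> Q p"
  shows "is_limit {p. P p} k f \<longrightarrow> is_limit {p. Q p} k f"
proof -
  have "{p. P p} \<subseteq> {p. Q p}"
    using assms by blast
  then show ?thesis
    unfolding is_limit_def by (meson subset_trans)
qed

inductive_set omega_clone :: "bfun set \<Rightarrow> bfun set" for F :: "bfun set" where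
  base: "p \<in> F \<Longrightarrow> p \<in> omega_clone F"
| eq: "EQ \<in> omega_clone F"
| fict: "(k, f) \<in> omega_clone F \<Longrightarrow> i \<le> k \<Longrightarrow> (Suc k, fictitious k i f) \<in> omega_clone F"
| perm: "(k, f) \<in> omega_clone F \<Longrightarrow> \<pi> permutes {..<k} \<Longrightarrow> (k, permute_args k \<pi> f) \<in> omega_clone F"
| mult: "(k, f) \<in> omega_clone F \<Longrightarrow> (k, g) \<in> omega_clone F \<Longrightarrow>
    (k, pointwise_mult k f g) \<in> omega_clone F"
| sum: "(Suc k, f) \<in> omega_clone F \<Longrightarrow> i \<le> k \<Longrightarrow> (k, sum_out k i f) \<in> omega_clone F"
| limit: "is_limit (omega_clone F) k f \<Longrightarrow> (k, f) \<in> omega_clone F"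


definition fourier :: "nat \<Rightarrow> (bool list \<Rightarrow> real) \<Rightarrow> bool list \<Rightarrow> real" where
  "fourier k f x = (\<Sum>w\<in>cube k. (-1) ^ weight (meet w x) * f w) / 2 ^ k"

definition SDP :: "bfun set" where
  "SDP = {(k, f) \<in> BB.
     (\<forall>x\<in>cube k. f x = f (compl x)) \<and>
     (\<forall>x\<in>cube k. fourier k f x \<ge> 0) \<and>
     (\<forall>x\<in>cube k. odd (weight x) \<longrightarrow> fourier k f x \<le> 0)}"

definition Ising :: "nat \<Rightarrow> real \<Rightarrow> bfun" where
  "Ising k l = (k, \<lambda>x\<in>cube k. if x = replicate k False \<or> x = replicate k True then 1 else l)"

definition H_ferro :: "bfun set" where
  "H_ferro = omega_clone ({Ising k l | k l. 2 \<le> k \<and> 0 \<le> l \<and> l \<le> 1} \<union> Bk 0)"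

end

theory Submission
  imports Defs
begin

text \<open>
  Both \<open>SDP\<close> and the class of log-supermodular functions are closed under the operations that
  generate \<open>omega_clone\<close> and contain the ferromagnetic Ising functions, so \<open>H_ferro\<close> lies in their
  intersection. The indicator of even Hamming weight in arity 4 is in \<open>SDP\<close>, having just two
  nonzero Fourier coefficients, but it is not log-supermodular.
\<close>

section \<open>The Boolean cube\<close>

lemma cube_0 [simp]: "cube 0 = {[]}"
  by (auto simp: cube_def)

lemma length_cube: "x \<in> cube k \<Longrightarrow> length x = k"
  by (simp add: cube_def)

lemma finite_cube [simp]: "finite (cube k)"
  using finite_lists_length_eq[of "UNIV :: bool set" k] by (simp add: cube_def)

lemma cube_nonempty [simp]: "cube k \<noteq> {}"
  using Ex_list_of_length by (auto simp: cube_def)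

lemma Cons_in_cube [simp]: "b # x \<in> cube (Suc k) \<longleftrightarrow> x \<in> cube k"
  by (simp add: cube_def)

lemma insert_arg_0: "insert_arg 0 b x = b # x"
  by (simp add: insert_arg_def)

lemma insert_arg_in_cube: "x \<in> cube k \<Longrightarrow> i \<le> k \<Longrightarrow> insert_arg i b x \<in> cube (Suc k)"
  by (simp add: cube_def insert_arg_def)

lemma delete_arg_in_cube: "x \<in> cube (Suc k) \<Longrightarrow> i \<le> k \<Longrightarrow> delete_arg i x \<in> cube k"
  by (simp add: cube_def delete_arg_def)

lemma delete_insert_arg: "x \<in> cube k \<Longrightarrow> i \<le> k \<Longrightarrow> delete_arg i (insert_arg i b x) = x"
  by (simp add: cube_def delete_arg_def insert_arg_def min_def)

lemma insert_delete_arg: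
  "x \<in> cube (Suc k) \<Longrightarrow> i \<le> k \<Longrightarrow> insert_arg i (x ! i) (delete_arg i x) = x"
  by (simp add: cube_def delete_arg_def insert_arg_def min_def id_take_nth_drop[symmetric])

text \<open>Splitting off the entry at position \<open>i\<close> is a bijection onto
  \<open>cube k \<times> UNIV\<close>. Keeping \<open>i\<close> arbitrary makes the Fourier
  recursion available at whichever argument is added or summed out.\<close>

lemma sum_cube_Suc:
  assumes "i \<le> k"
  shows "(\<Sum>w\<in>cube (Suc k). g w) = (\<Sum>u\<in>cube k. \<Sum>b\<in>UNIV. g (insert_arg i b u))"
proof -
  have "(\<Sum>w\<in>cube (Suc k). g w) = (\<Sum>(u, b)\<in>cube k \<times> UNIV. g (insert_arg i b u))"
  proof (rule sum.reindex_bij_witness[where j = "\<lambda>w. (delete_arg i w, w ! i)"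
        and i = "\<lambda>(u, b). insert_arg i b u"])
    show "(delete_arg i (case p of (u, b) \<Rightarrow> insert_arg i b u),
        (case p of (u, b) \<Rightarrow> insert_arg i b u) ! i) = p" if "p \<in> cube k \<times> UNIV" for p
      using that assms by (auto simp: delete_insert_arg) (auto simp: insert_arg_def nth_append cube_def)
  qed (use assms in \<open>auto simp: insert_delete_arg delete_arg_in_cube insert_arg_in_cube\<close>)
  then show ?thesis
    by (simp add: sum.cartesian_product)
qed

section \<open>Lattice operations, complement and Hamming weight\<close>

definition join :: "bool list \<Rightarrow> bool list \<Rightarrow> bool list" where
  "join x y = map2 (\<or>) x y"

lemma meet_in_cube: "x \<in> cube k \<Longrightarrow> y \<in> cube k \<Longrightarrow> meet x y \<in> cube k"
  by (simp add: cube_def meet_def)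

lemma join_in_cube: "x \<in> cube k \<Longrightarrow> y \<in> cube k \<Longrightarrow> join x y \<in> cube k"
  by (simp add: cube_def join_def)

lemma compl_in_cube [simp]: "compl x \<in> cube k \<longleftrightarrow> x \<in> cube k"
  by (simp add: cube_def compl_def)

lemma compl_compl [simp]: "compl (compl x) = x"
  by (simp add: compl_def comp_def)

lemma permute_in_cube: "x \<in> cube k \<Longrightarrow> permute_list \<pi> x \<in> cube k"
  by (simp add: cube_def)

lemma weight_simps [simp]:
  "weight [] = 0" "weight (True # x) = Suc (weight x)" "weight (False # x) = weight x"
  by (simp_all add: weight_def)

lemma weight_append [simp]: "weight (x @ y) = weight x + weight y"
  by (simp add: weight_def)

lemma meet_simps [simp]: "meet [] x = []" "meet (a # x) (b # y) = (a \<and> b) # meet x y"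
  by (simp_all add: meet_def)

lemma join_simps [simp]: "join [] x = []" "join (a # x) (b # y) = (a \<or> b) # join x y"
  by (simp_all add: join_def)

text \<open>A general \<open>h\<close> covers \<open>meet\<close> and \<open>join\<close> at once;
  both are obtained by folding their definitions.\<close>

lemma map2_insert_arg:
  assumes "x \<in> cube k" "y \<in> cube k" "i \<le> k"
  shows "map2 h (insert_arg i a x) (insert_arg i b y) = insert_arg i (h a b) (map2 h x y)"
  using assms by (simp add: insert_arg_def cube_def take_zip drop_zip take_map drop_map)

lemmas meet_insert_arg = map2_insert_arg[where h = "(\<and>)", folded meet_def]
lemmas join_insert_arg = map2_insert_arg[where h = "(\<or>)", folded join_def]

lemma map2_delete_arg:
  assumes "x \<in> cube (Suc k)" "y \<in> cube (Suc k)" "i \<le> k"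
  shows "map2 h (delete_arg i x) (delete_arg i y) = delete_arg i (map2 h x y)"
  using assms by (simp add: delete_arg_def cube_def take_zip drop_zip take_map drop_map)

lemmas meet_delete_arg = map2_delete_arg[where h = "(\<and>)", folded meet_def]
lemmas join_delete_arg = map2_delete_arg[where h = "(\<or>)", folded join_def]

lemma map2_permute_list:
  assumes "x \<in> cube k" "y \<in> cube k" "\<pi> permutes {..<k}"
  shows "map2 h (permute_list \<pi> x) (permute_list \<pi> y) = permute_list \<pi> (map2 h x y)"
  using assms by (simp add: cube_def permute_list_zip[symmetric] permute_list_map)

lemmas meet_permute_list = map2_permute_list[where h = "(\<and>)", folded meet_def]
lemmas join_permute_list = map2_permute_list[where h = "(\<or>)", folded join_def]

lemma compl_insert_arg: "compl (insert_arg i b x) = insert_arg i (\<not> b) (compl x)"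
  by (simp add: compl_def insert_arg_def take_map drop_map)

lemma compl_delete_arg: "compl (delete_arg i x) = delete_arg i (compl x)"
  by (simp add: compl_def delete_arg_def take_map drop_map)

lemma compl_permute_list:
  "x \<in> cube k \<Longrightarrow> \<pi> permutes {..<k} \<Longrightarrow> compl (permute_list \<pi> x) = permute_list \<pi> (compl x)"
  by (simp add: compl_def cube_def permute_list_map)

lemma weight_insert_arg: "weight (insert_arg i b x) = weight x + of_bool b"
proof -
  have "weight x = weight (take i x) + weight (drop i x)"
    by (metis append_take_drop_id weight_append)
  then show ?thesis
    by (cases b) (simp_all add: insert_arg_def)
qed

lemma weight_permute_list:
  assumes "x \<in> cube k" "\<pi> permutes {..<k}"
  shows "weight (permute_list \<pi> x) = weight x"
  using assms by (simp add: weight_def cube_def flip: count_mset)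

lemma weight_compl: "weight x + weight (compl x) = length x"
proof (induction x)
  case (Cons a x)
  then show ?case by (cases a) (auto simp: compl_def)
qed (simp add: compl_def)

text \<open>Each true entry of \<open>x\<close> survives in exactly one of the two meets.\<close>

lemma weight_meet_compl:
  "length w = length x \<Longrightarrow> weight (meet w x) + weight (meet (compl w) x) = weight x"
proof (induction w x rule: list_induct2)
  case (Cons a w b x)
  then show ?case by (cases a; cases b) (auto simp: compl_def)
qed (simp add: compl_def)

lemma meet_replicate:
  "length x = k \<Longrightarrow> meet (replicate k True) x = x"
  "length x = k \<Longrightarrow> weight (meet (replicate k False) x) = 0"
  by (induction x arbitrary: k) auto


section \<open>Functions with nonnegative Fourier transform\<close>

text \<open>Stated for raw functions of any sign: the inductions pass to differences of
  restrictions, which may be negative and are not extensional.\<close>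

definition fourier_nonneg :: "nat \<Rightarrow> (bool list \<Rightarrow> real) \<Rightarrow> bool" where
  "fourier_nonneg k f \<longleftrightarrow> (\<forall>x\<in>cube k. 0 \<le> fourier k f x)"

lemma fourier_cong: "(\<And>w. w \<in> cube k \<Longrightarrow> f w = g w) \<Longrightarrow> fourier k f = fourier k g"
  by (auto simp: fourier_def fun_eq_iff intro!: sum.cong)

lemma fourier_nonneg_cong:
  "(\<And>w. w \<in> cube k \<Longrightarrow> f w = g w) \<Longrightarrow> fourier_nonneg k f \<longleftrightarrow> fourier_nonneg k g"
  unfolding fourier_nonneg_def by (metis fourier_cong)

lemma fourier_add: "fourier k (\<lambda>w. f w + g w) x = fourier k f x + fourier k g x"
  by (simp add: fourier_def algebra_simps sum.distrib add_divide_distrib)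

lemma fourier_scale: "fourier k (\<lambda>w. c * f w) x = c * fourier k f x"
  by (simp add: fourier_def sum_distrib_left mult.left_commute)

lemma fourier_nonneg_add:
  "fourier_nonneg k f \<Longrightarrow> fourier_nonneg k g \<Longrightarrow> fourier_nonneg k (\<lambda>w. f w + g w)"
  by (simp add: fourier_nonneg_def fourier_add)

lemma fourier_nonneg_scale: "fourier_nonneg k f \<Longrightarrow> 0 \<le> c \<Longrightarrow> fourier_nonneg k (\<lambda>w. c * f w)"
  by (simp add: fourier_nonneg_def fourier_scale)

text \<open>The character at \<open>insert_arg i c x\<close> is the character at \<open>x\<close>
  times a sign, which is negative only if both entries at \<open>i\<close> are true. The division by
  2 comes from the normalisation \<open>2 ^ Suc k\<close>.\<close>

lemma fourier_Suc:
  assumes "i \<le> k" "x \<in> cube k"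
  shows "fourier (Suc k) f (insert_arg i c x) =
    fourier k (\<lambda>u. f (insert_arg i False u) + (-1) ^ of_bool c * f (insert_arg i True u)) x / 2"
proof -
  have "weight (meet (insert_arg i b u) (insert_arg i c x)) = weight (meet u x) + of_bool (b \<and> c)"
    if "u \<in> cube k" for b u
    using that assms by (simp add: meet_insert_arg weight_insert_arg)
  then show ?thesis
    unfolding fourier_def sum_cube_Suc[OF assms(1)]
    by (auto simp: UNIV_bool power_add algebra_simps intro!: sum.cong)
qed

lemma cube_Suc_insert_arg:
  assumes "i \<le> k"
  shows "(\<forall>x\<in>cube (Suc k). P x) \<longleftrightarrow> (\<forall>x\<in>cube k. P (insert_arg i False x) \<and> P (insert_arg i True x))"
  by (metis (full_types) assms delete_arg_in_cube insert_arg_in_cube insert_delete_arg)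

text \<open>Frequencies with a false entry at \<open>i\<close> see the sum of the two restrictions,
  those with a true entry see the difference. This recursion drives the inductions on arity
  below.\<close>

lemma fourier_nonneg_Suc:
  assumes "i \<le> k"
  shows "fourier_nonneg (Suc k) f \<longleftrightarrow>
     fourier_nonneg k (\<lambda>u. f (insert_arg i False u) + f (insert_arg i True u)) \<and>
     fourier_nonneg k (\<lambda>u. f (insert_arg i False u) - f (insert_arg i True u))"
  unfolding fourier_nonneg_def cube_Suc_insert_arg[OF assms]
  using assms by (auto simp: fourier_Suc)

lemma fourier_nonneg_0: "fourier_nonneg 0 f \<longleftrightarrow> 0 \<le> f []"
  by (simp add: fourier_nonneg_def fourier_def)

text \<open>The constant is generalised because the recursion calls for \<open>c + c\<close> (sum)
  and 0 (difference).\<close>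

lemma fourier_nonneg_const: "0 \<le> c \<Longrightarrow> fourier_nonneg k (\<lambda>_. c)"
proof (induction k arbitrary: c)
  case (Suc k)
  then show ?case
    using Suc.IH[of "c + c"] Suc.IH[of 0] by (simp add: fourier_nonneg_Suc[of 0])
qed (simp add: fourier_nonneg_0)

text \<open>The two restrictions are negatives of each other, so their sum vanishes and their
  difference is twice the parity function of lower arity.\<close>

lemma fourier_nonneg_parity: "fourier_nonneg k (\<lambda>w. (-1) ^ weight w)"
proof (induction k)
  case (Suc k)
  have "fourier_nonneg k (\<lambda>w. 2 * (-1) ^ weight w)"
    using fourier_nonneg_scale[OF Suc, of 2] by simp
  then show ?case
    by (simp add: fourier_nonneg_Suc[of 0] insert_arg_0 fourier_nonneg_const)
qed (simp add: fourier_nonneg_0)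

text \<open>
  Induction on the arity replaces the convolution theorem: with \<open>f\<^sub>b\<close>, \<open>g\<^sub>b\<close> the restrictions to
  first argument \<open>b\<close>, the functions \<open>f\<^sub>0 g\<^sub>0 + f\<^sub>1 g\<^sub>1\<close> and \<open>f\<^sub>0 g\<^sub>0 - f\<^sub>1 g\<^sub>1\<close> are half the sums of
  products of \<open>f\<^sub>0 + f\<^sub>1\<close> or \<open>f\<^sub>0 - f\<^sub>1\<close> with \<open>g\<^sub>0 + g\<^sub>1\<close> or \<open>g\<^sub>0 - g\<^sub>1\<close>.
\<close>

lemma fourier_nonneg_mult:
  "fourier_nonneg k f \<Longrightarrow> fourier_nonneg k g \<Longrightarrow> fourier_nonneg k (\<lambda>w. f w * g w)"
proof (induction k arbitrary: f g)
  case (Suc k)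
  define fp fm gp gm where
    "fp = (\<lambda>u. f (False # u) + f (True # u))" and "fm = (\<lambda>u. f (False # u) - f (True # u))" and
    "gp = (\<lambda>u. g (False # u) + g (True # u))" and "gm = (\<lambda>u. g (False # u) - g (True # u))"
  have nonneg: "fourier_nonneg k fp" "fourier_nonneg k fm" "fourier_nonneg k gp" "fourier_nonneg k gm"
    using Suc.prems by (simp_all add: fourier_nonneg_Suc[of 0] insert_arg_0 fp_def fm_def gp_def gm_def)
  have "fourier_nonneg k (\<lambda>u. (1/2) * (fp u * gp u + fm u * gm u))"
    "fourier_nonneg k (\<lambda>u. (1/2) * (fp u * gm u + fm u * gp u))"
    by (intro fourier_nonneg_scale fourier_nonneg_add Suc.IH nonneg; simp)+
  moreover have
    "(\<lambda>u. (1/2) * (fp u * gp u + fm u * gm u)) =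
      (\<lambda>u. f (False # u) * g (False # u) + f (True # u) * g (True # u))"
    "(\<lambda>u. (1/2) * (fp u * gm u + fm u * gp u)) =
      (\<lambda>u. f (False # u) * g (False # u) - f (True # u) * g (True # u))"
    by (auto simp: fp_def fm_def gp_def gm_def algebra_simps)
  ultimately show ?case
    by (simp add: fourier_nonneg_Suc[of 0] insert_arg_0)
qed (simp add: fourier_nonneg_0)

section \<open>Preservation of Fourier nonnegativity, and odd coefficients\<close>

lemma fourier_nonneg_fictitious:
  assumes "fourier_nonneg k f" "i \<le> k"
  shows "fourier_nonneg (Suc k) (fictitious k i f)"
proof -
  have eq: "fictitious k i f (insert_arg i b u) = f u" if "u \<in> cube k" for b u
    using that assms(2) by (simp add: fictitious_def insert_arg_in_cube delete_insert_arg)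
  \<comment> \<open>Both restrictions at \<open>i\<close> equal \<open>f\<close>, so these are their
    sum and difference.\<close>
  have "fourier_nonneg k (\<lambda>u. 2 * f u)" "fourier_nonneg k (\<lambda>u. 0)"
    using assms(1) by (simp_all add: fourier_nonneg_scale fourier_nonneg_const)
  then show ?thesis
    unfolding fourier_nonneg_Suc[OF assms(2)] by (simp add: eq cong: fourier_nonneg_cong)
qed

text \<open>Permuting both arguments of \<open>meet\<close> leaves its weight unchanged, so
  reindexing the sum moves the permutation from the function to the frequency.\<close>

lemma fourier_nonneg_permute:
  assumes "fourier_nonneg k f" "\<pi> permutes {..<k}"
  shows "fourier_nonneg k (permute_args k \<pi> f)"
  unfolding fourier_nonneg_def
proof
  fix x assume x: "x \<in> cube k"
  have "(\<Sum>w\<in>cube k. (-1) ^ weight (meet w x) * permute_args k \<pi> f w) =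
    (\<Sum>w\<in>cube k. (-1) ^ weight (meet w (permute_list \<pi> x)) * f w)"
  proof (rule sum.reindex_bij_witness[where j = "permute_list \<pi>" and i = "permute_list (inv \<pi>)"])
    fix w assume w: "w \<in> cube k"
    show "permute_list (inv \<pi>) (permute_list \<pi> w) = w"
      "permute_list \<pi> (permute_list (inv \<pi>) w) = w"
      using w assms(2) permutes_inv[OF assms(2)]
      by (simp_all add: permutes_inv_o cube_def flip: permute_list_compose)
    have "weight (meet (permute_list \<pi> w) (permute_list \<pi> x)) = weight (meet w x)"
      using w x assms(2)
      by (simp add: meet_permute_list weight_permute_list[OF meet_in_cube])
    then show "(-1) ^ weight (meet (permute_list \<pi> w) (permute_list \<pi> x)) * f (permute_list \<pi> w) =
        (-1) ^ weight (meet w x) * permute_args k \<pi> f w"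
      using w by (simp add: permute_args_def)
  qed (auto intro: permute_in_cube)
  then have "fourier k (permute_args k \<pi> f) x = fourier k f (permute_list \<pi> x)"
    by (simp add: fourier_def)
  then show "0 \<le> fourier k (permute_args k \<pi> f) x"
    using assms(1) x by (simp add: fourier_nonneg_def permute_in_cube)
qed

lemma fourier_nonneg_sum_out:
  assumes "fourier_nonneg (Suc k) f" "i \<le> k"
  shows "fourier_nonneg k (sum_out k i f)"
proof -
  have "fourier_nonneg k (\<lambda>u. f (insert_arg i False u) + f (insert_arg i True u))"
    using assms by (simp add: fourier_nonneg_Suc[OF assms(2)])
  then show ?thesis
    by (subst fourier_nonneg_cong[where g = "\<lambda>u. f (insert_arg i False u) + f (insert_arg i True u)"])
       (auto simp: sum_out_def UNIV_bool)
qed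

text \<open>Each coefficient is a finite linear combination of values, hence continuous under
  pointwise convergence, and the half-line of nonnegative reals is closed.\<close>

lemma fourier_nonneg_limit:
  assumes "\<And>n. fourier_nonneg k (g n)" "\<And>x. x \<in> cube k \<Longrightarrow> (\<lambda>n. g n x) \<longlonglongrightarrow> f x"
  shows "fourier_nonneg k f"
  unfolding fourier_nonneg_def
proof
  fix x assume x: "x \<in> cube k"
  have "(\<lambda>n. fourier k (g n) x) \<longlonglongrightarrow> fourier k f x"
    unfolding fourier_def by (intro tendsto_intros assms(2)) auto
  then show "0 \<le> fourier k f x"
    using assms(1) x by (auto simp: fourier_nonneg_def intro: LIMSEQ_le_const)
qed

text \<open>At a frequency of odd weight the character changes sign when \<open>w\<close> is
  complemented, while \<open>f\<close> does not, so the sum equals its own negative.\<close>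

lemma fourier_odd_weight:
  assumes "\<And>w. w \<in> cube k \<Longrightarrow> f (compl w) = f w" "x \<in> cube k" "odd (weight x)"
  shows "fourier k f x = 0"
proof -
  have "(\<Sum>w\<in>cube k. (-1) ^ weight (meet w x) * f w) = (\<Sum>w\<in>cube k. - ((-1) ^ weight (meet w x) * f w))"
  proof (rule sum.reindex_bij_witness[where j = compl and i = compl])
    fix w assume w: "w \<in> cube k"
    have "odd (weight (meet w x) + weight (meet (compl w) x))"
      using assms(2,3) w by (simp add: weight_meet_compl cube_def)
    then have "(-1 :: real) ^ weight (meet (compl w) x) = - ((-1) ^ weight (meet w x))"
      by (simp add: minus_one_power_iff)
    then show "- ((-1) ^ weight (meet (compl w) x) * f (compl w)) = (-1) ^ weight (meet w x) * f w"
      using assms(1)[OF w] by simp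
  qed auto
  then have "(\<Sum>w\<in>cube k. (-1) ^ weight (meet w x) * f w) = 0"
    by (simp add: sum_negf)
  then show ?thesis
    by (simp add: fourier_def)
qed


section \<open>Classes closed under the clone operations and limits\<close>

lemma mem_Bk: "(k, f) \<in> Bk k \<longleftrightarrow> f \<in> extensional (cube k) \<and> (\<forall>x\<in>cube k. 0 \<le> f x)"
  by (auto simp: Bk_def PiE_def Pi_def)

lemma mem_BB: "(k, f) \<in> BB \<longleftrightarrow> (k, f) \<in> Bk k"
  by (auto simp: BB_def Bk_def)

lemma Bk_fict: "(k, f) \<in> Bk k \<Longrightarrow> i \<le> k \<Longrightarrow> (Suc k, fictitious k i f) \<in> Bk (Suc k)"
  by (auto simp: mem_Bk fictitious_def delete_arg_in_cube)

lemma Bk_perm: "(k, f) \<in> Bk k \<Longrightarrow> (k, permute_args k \<pi> f) \<in> Bk k"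
  by (auto simp: mem_Bk permute_args_def permute_in_cube)

lemma Bk_mult: "(k, f) \<in> Bk k \<Longrightarrow> (k, g) \<in> Bk k \<Longrightarrow> (k, pointwise_mult k f g) \<in> Bk k"
  by (auto simp: mem_Bk pointwise_mult_def)

lemma Bk_sum: "(Suc k, f) \<in> Bk (Suc k) \<Longrightarrow> i \<le> k \<Longrightarrow> (k, sum_out k i f) \<in> Bk k"
  by (auto simp: mem_Bk sum_out_def insert_arg_in_cube intro!: sum_nonneg)

text \<open>The rules of \<open>omega_clone\<close> with the limit rule in sequential form:
  pointwise convergence on the cube replaces the finite set and the maximum, so an instance only has
  to check continuity of its defining conditions.\<close>

locale omega_closed =
  fixes P :: "bfun set"
  assumes eq: "EQ \<in> P"
    and fict: "(k, f) \<in> P \<Longrightarrow> i \<le> k \<Longrightarrow> (Suc k, fictitious k i f) \<in> P"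
    and perm: "(k, f) \<in> P \<Longrightarrow> \<pi> permutes {..<k} \<Longrightarrow> (k, permute_args k \<pi> f) \<in> P"
    and mult: "(k, f) \<in> P \<Longrightarrow> (k, g) \<in> P \<Longrightarrow> (k, pointwise_mult k f g) \<in> P"
    and sum: "(Suc k, f) \<in> P \<Longrightarrow> i \<le> k \<Longrightarrow> (k, sum_out k i f) \<in> P"
    and lim: "(k, f) \<in> Bk k \<Longrightarrow> (\<And>n. (k, h n) \<in> P) \<Longrightarrow>
      (\<And>x. x \<in> cube k \<Longrightarrow> (\<lambda>n. h n x) \<longlonglongrightarrow> f x) \<Longrightarrow> (k, f) \<in> P"
begin

lemma clone_subset:
  assumes "F \<subseteq> P"
  shows "clone F \<subseteq> P"
proof
  fix p assume "p \<in> clone F"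
  then show "p \<in> P"
    by induction (use assms in \<open>auto intro: eq fict perm mult sum\<close>)
qed

lemma is_limit_mem:
  assumes "is_limit P k f"
  shows "(k, f) \<in> P"
proof -
  obtain S where S: "S \<subseteq> P"
    and approx: "\<And>\<epsilon>. \<epsilon> > 0 \<Longrightarrow> \<exists>g. (k, g) \<in> clone S \<and> (MAX x\<in>cube k. \<bar>f x - g x\<bar>) < \<epsilon>"
    and f: "(k, f) \<in> Bk k"
    using assms unfolding is_limit_def by blast
  have "\<forall>n. \<exists>g. (k, g) \<in> clone S \<and> (MAX x\<in>cube k. \<bar>f x - g x\<bar>) < 1 / real (Suc n)"
    using approx by simp
  then obtain h where h: "\<And>n. (k, h n) \<in> clone S"
    "\<And>n. (MAX x\<in>cube k. \<bar>f x - h n x\<bar>) < 1 / real (Suc n)"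
    by metis
  show ?thesis
  proof (rule lim[OF f])
    show "(k, h n) \<in> P" for n
      using clone_subset[OF S] h(1) by blast
    show "(\<lambda>n. h n x) \<longlonglongrightarrow> f x" if "x \<in> cube k" for x
    \<comment> \<open>The cube is finite and nonempty, so the bound on the maximum holds at every
      point.\<close>
    proof (rule LIM_zero_cancel[OF LIMSEQ_norm_0])
      fix n
      show "norm (h n x - f x) < 1 / real (Suc n)"
        using h(2)[of n] that by (simp add: abs_minus_commute)
    qed
  qed
qed

lemma omega_clone_subset:
  assumes "F \<subseteq> P"
  shows "omega_clone F \<subseteq> P"
proof
  fix p assume "p \<in> omega_clone F"
  then show "p \<in> P"
  proof induction
    case (limit k f)
    \<comment> \<open>The induction hypothesis provides a finite set whose members lie in
      \<open>omega_clone F\<close> and also in \<open>P\<close>; the same set and approximants serve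
      for \<open>P\<close>.\<close>
    then have "is_limit P k f"
      unfolding is_limit_def by blast
    then show ?case
      by (rule is_limit_mem)
  qed (use assms in \<open>auto intro: eq fict perm mult sum\<close>)
qed

end

section \<open>Membership in the two classes, and closure of \<open>SDP\<close>\<close>

lemma mem_SDP:
  "(k, f) \<in> SDP \<longleftrightarrow> (k, f) \<in> Bk k \<and> (\<forall>x\<in>cube k. f (compl x) = f x) \<and> fourier_nonneg k f"
proof -
  have "(k, f) \<in> SDP \<longleftrightarrow> (k, f) \<in> Bk k \<and> (\<forall>x\<in>cube k. f (compl x) = f x) \<and>
      fourier_nonneg k f \<and> (\<forall>x\<in>cube k. odd (weight x) \<longrightarrow> fourier k f x \<le> 0)"
    by (simp add: SDP_def mem_BB fourier_nonneg_def eq_commute[of "f (compl _)"])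
  \<comment> \<open>Self-duality makes the coefficients of odd weight vanish.\<close>
  moreover have "fourier k f x \<le> 0"
    if "\<forall>x\<in>cube k. f (compl x) = f x" "x \<in> cube k" "odd (weight x)" for x
    using fourier_odd_weight[of k f x] that by simp
  ultimately show ?thesis
    by blast
qed

text \<open>The FKG lattice condition, in product form so that the value 0 is allowed.\<close>

definition LSM :: "bfun set" where
  "LSM = {(k, f) \<in> BB. \<forall>x\<in>cube k. \<forall>y\<in>cube k. f x * f y \<le> f (meet x y) * f (join x y)}"

lemma mem_LSM:
  "(k, f) \<in> LSM \<longleftrightarrow>
    (k, f) \<in> Bk k \<and> (\<forall>x\<in>cube k. \<forall>y\<in>cube k. f x * f y \<le> f (meet x y) * f (join x y))"
  by (auto simp: LSM_def mem_BB)

lemma Ising_mem_Bk: "0 \<le> l \<Longrightarrow> Ising k l \<in> Bk k"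
  by (auto simp: Ising_def mem_Bk)

text \<open>This reduces the membership of \<open>EQ\<close> in each class to the Ising
  case.\<close>

lemma EQ_eq_Ising: "EQ = Ising 2 0"
proof -
  have "x ! 0 = x ! 1 \<longleftrightarrow> x = replicate 2 False \<or> x = replicate 2 True" if "x \<in> cube 2" for x
    using that by (auto simp: cube_def numeral_2_eq_2 length_Suc_conv)
  then show ?thesis
    by (auto simp: EQ_def Ising_def intro!: restrict_ext)
qed

text \<open>Only the two constant points contribute, and the character takes the values 1 and
  \<open>(-1) ^ weight x\<close> there. Positive arity keeps these points distinct.\<close>

lemma fourier_nonneg_all_equal:
  assumes "0 < k"
  shows "fourier_nonneg k (\<lambda>w. if w = replicate k False \<or> w = replicate k True then 1 else 0)"
  unfolding fourier_nonneg_def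
proof
  fix x assume x: "x \<in> cube k"
  have ne: "replicate k False \<noteq> replicate k True"
    using assms by (cases k) auto
  have sub: "{replicate k False, replicate k True} \<subseteq> cube k"
    by (auto simp: cube_def)
  have "(\<Sum>w\<in>cube k. (-1) ^ weight (meet w x) *
      (if w = replicate k False \<or> w = replicate k True then 1 else 0)) =
    (\<Sum>w\<in>{replicate k False, replicate k True}. (-1 :: real) ^ weight (meet w x))"
    by (rule sum.mono_neutral_cong_right) (use sub in auto)
  also have "\<dots> = 1 + (-1) ^ weight x"
    using ne x by (simp add: meet_replicate length_cube)
  also have "\<dots> \<ge> 0"
    by (simp add: minus_one_power_iff)
  finally show "0 \<le> fourier k (\<lambda>w. if w = replicate k False \<or> w = replicate k True then 1 else 0) x"
    by (simp add: fourier_def)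
qed

lemma Ising_mem_SDP:
  assumes "0 < k" "0 \<le> l" "l \<le> 1"
  shows "Ising k l \<in> SDP"
proof -
  define e :: "bool list \<Rightarrow> real"
    where "e = (\<lambda>w. if w = replicate k False \<or> w = replicate k True then 1 else 0)"
  \<comment> \<open>For \<open>l\<close> between 0 and 1 the Ising function is a convex combination
    of the constant 1 and the all-equal indicator.\<close>
  have "fourier_nonneg k (\<lambda>w. l + (1 - l) * e w)"
    using assms fourier_nonneg_all_equal[of k]
    by (intro fourier_nonneg_add fourier_nonneg_scale fourier_nonneg_const) (auto simp: e_def)
  then have "fourier_nonneg k (snd (Ising k l))"
    by (rule iffD1[OF fourier_nonneg_cong, rotated]) (simp add: Ising_def e_def)
  moreover have "compl x = replicate k b \<longleftrightarrow> x = replicate k (\<not> b)" for x b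
    by (metis (full_types) compl_compl compl_def map_replicate)
  ultimately show ?thesis
    using Ising_mem_Bk[OF assms(2), of k] by (auto simp: Ising_def mem_SDP)
qed

interpretation SDP: omega_closed SDP
proof
  show "EQ \<in> SDP"
    unfolding EQ_eq_Ising by (rule Ising_mem_SDP) auto
next
  fix k f i assume "(k, f) \<in> SDP" "i \<le> k"
  then show "(Suc k, fictitious k i f) \<in> SDP"
    by (simp add: mem_SDP Bk_fict fourier_nonneg_fictitious)
       (auto simp: fictitious_def delete_arg_in_cube compl_delete_arg[symmetric])
next
  fix k f \<pi> assume "(k, f) \<in> SDP" "\<pi> permutes {..<k}"
  then show "(k, permute_args k \<pi> f) \<in> SDP"
    by (simp add: mem_SDP Bk_perm fourier_nonneg_permute)
       (auto simp: permute_args_def permute_in_cube compl_permute_list[symmetric])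
next
  fix k f g assume *: "(k, f) \<in> SDP" "(k, g) \<in> SDP"
  have "fourier_nonneg k (pointwise_mult k f g)"
    by (rule iffD1[OF fourier_nonneg_cong, OF _ fourier_nonneg_mult[of k f g]])
       (use * in \<open>auto simp: mem_SDP pointwise_mult_def\<close>)
  with * show "(k, pointwise_mult k f g) \<in> SDP"
    by (simp add: mem_SDP Bk_mult) (auto simp: pointwise_mult_def)
next
  fix k f i assume *: "(Suc k, f) \<in> SDP" "i \<le> k"
  \<comment> \<open>Complementing the remaining arguments exchanges the two summands of
    \<open>sum_out\<close>.\<close>
  then have "f (insert_arg i (\<not> b) (compl x)) = f (insert_arg i b x)" if "x \<in> cube k" for x b
    using that by (simp add: mem_SDP insert_arg_in_cube compl_insert_arg[symmetric])
  from this[of _ True] this[of _ False] * show "(k, sum_out k i f) \<in> SDP"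
    by (simp add: mem_SDP Bk_sum fourier_nonneg_sum_out) (simp add: sum_out_def UNIV_bool)
next
  fix k f h
  assume f: "(k, f) \<in> Bk k" and h: "\<And>n. (k, h n) \<in> SDP"
    and lim: "\<And>x. x \<in> cube k \<Longrightarrow> (\<lambda>n. h n x) \<longlonglongrightarrow> f x"
  have "f (compl x) = f x" if "x \<in> cube k" for x
    using lim[OF that] lim[of "compl x"] h that
    by (auto simp: mem_SDP intro: LIMSEQ_unique)
  moreover have "fourier_nonneg k f"
    using fourier_nonneg_limit[OF _ lim] h by (auto simp: mem_SDP)
  ultimately show "(k, f) \<in> SDP"
    using f by (simp add: mem_SDP)
qed


section \<open>Log-supermodular functions\<close>

text \<open>If one point is the bottom or top of the cube, meet and join are the two given points
  again and equality holds. Otherwise the left side is \<open>l * l\<close>, and \<open>l\<close> is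
  the least value of the function.\<close>

lemma Ising_mem_LSM:
  assumes "0 \<le> l" "l \<le> 1"
  shows "Ising k l \<in> LSM"
proof -
  define v where "v = snd (Ising k l)"
  have v: "v x = (if x = replicate k False \<or> x = replicate k True then 1 else l)" if "x \<in> cube k" for x
    using that by (simp add: v_def Ising_def)
  have meet: "meet (replicate k True) x = x" "meet x (replicate k True) = x"
    "meet (replicate k False) x = replicate k False" "meet x (replicate k False) = replicate k False"
    if "x \<in> cube k" for x
    using that by (auto simp: meet_def cube_def list_eq_iff_nth_eq)
  have join: "join (replicate k True) x = replicate k True" "join x (replicate k True) = replicate k True"
    "join (replicate k False) x = x" "join x (replicate k False) = x"
    if "x \<in> cube k" for x
    using that by (auto simp: join_def cube_def list_eq_iff_nth_eq)
  have "v x * v y \<le> v (meet x y) * v (join x y)" if xy: "x \<in> cube k" "y \<in> cube k" for x y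
  proof (cases "x \<in> {replicate k False, replicate k True} \<or> y \<in> {replicate k False, replicate k True}")
    case True
    then show ?thesis
      using xy by (auto simp: meet join)
  next
    case False
    then have "v x = l" "v y = l"
      using xy by (auto simp: v)
    moreover have "l \<le> v (meet x y)" "l \<le> v (join x y)"
      using xy assms by (auto simp: v meet_in_cube join_in_cube)
    ultimately show ?thesis
      using assms by (simp add: mult_mono)
  qed
  then show ?thesis
    using Ising_mem_Bk[OF assms(1), of k] by (simp add: mem_LSM Ising_def v_def)
qed

text \<open>The one-bit case of the Ahlswede-Daykin four functions theorem; it is what makes
  log-supermodularity survive summing out.\<close>

lemma four_functions:
  fixes a\<^sub>0 a\<^sub>1 b\<^sub>0 b\<^sub>1 c\<^sub>0 c\<^sub>1 d\<^sub>0 d\<^sub>1 :: real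
  assumes nonneg: "0 \<le> a\<^sub>0" "0 \<le> a\<^sub>1" "0 \<le> b\<^sub>0" "0 \<le> b\<^sub>1" "0 \<le> c\<^sub>0" "0 \<le> c\<^sub>1" "0 \<le> d\<^sub>0" "0 \<le> d\<^sub>1"
    and le: "a\<^sub>0 * b\<^sub>0 \<le> c\<^sub>0 * d\<^sub>0" "a\<^sub>0 * b\<^sub>1 \<le> c\<^sub>0 * d\<^sub>1" "a\<^sub>1 * b\<^sub>0 \<le> c\<^sub>0 * d\<^sub>1" "a\<^sub>1 * b\<^sub>1 \<le> c\<^sub>1 * d\<^sub>1"
  shows "(a\<^sub>0 + a\<^sub>1) * (b\<^sub>0 + b\<^sub>1) \<le> (c\<^sub>0 + c\<^sub>1) * (d\<^sub>0 + d\<^sub>1)"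
proof -
  \<comment> \<open>These are the cross terms. The diagonal terms are compared directly by the
    hypotheses, so it remains to show \<open>p + q \<le> s + t\<close>.\<close>
  define p q s t where "p = a\<^sub>0 * b\<^sub>1" "q = a\<^sub>1 * b\<^sub>0" "s = c\<^sub>0 * d\<^sub>1" "t = c\<^sub>1 * d\<^sub>0"
  have pos: "0 \<le> p" "0 \<le> q" "0 \<le> t" "p \<le> s" "q \<le> s"
    using nonneg le by (simp_all add: p_q_s_t_def)
  have "(a\<^sub>0 * b\<^sub>0) * (a\<^sub>1 * b\<^sub>1) \<le> (c\<^sub>0 * d\<^sub>0) * (c\<^sub>1 * d\<^sub>1)"
    using nonneg le by (simp add: mult_mono)
  then have "p * q \<le> s * t"
    by (simp add: p_q_s_t_def mult_ac)
  moreover have "0 \<le> (s - p) * (s - q)"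
    using pos by simp
  ultimately have "s * (p + q) \<le> s * (s + t)"
    by (simp add: algebra_simps)
  \<comment> \<open>If \<open>s = 0\<close>, then \<open>p\<close> and \<open>q\<close> vanish too;
    otherwise \<open>s\<close> cancels.\<close>
  then have "p + q \<le> s + t"
    using pos by (cases "s = 0") auto
  then show ?thesis
    using le by (simp add: p_q_s_t_def algebra_simps)
qed

interpretation LSM: omega_closed LSM
proof
  show "EQ \<in> LSM"
    unfolding EQ_eq_Ising by (rule Ising_mem_LSM) auto
next
  fix k f i assume *: "(k, f) \<in> LSM" "i \<le> k"
  then show "(Suc k, fictitious k i f) \<in> LSM"
    by (simp add: mem_LSM Bk_fict)
       (simp add: fictitious_def meet_in_cube join_in_cube delete_arg_in_cube
         flip: meet_delete_arg join_delete_arg)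
next
  fix k f \<pi> assume "(k, f) \<in> LSM" "\<pi> permutes {..<k}"
  then show "(k, permute_args k \<pi> f) \<in> LSM"
    by (simp add: mem_LSM Bk_perm)
       (simp add: permute_args_def meet_in_cube join_in_cube permute_in_cube
         flip: meet_permute_list join_permute_list)
next
  fix k f g assume *: "(k, f) \<in> LSM" "(k, g) \<in> LSM"
  have "(f x * g x) * (f y * g y) \<le> (f (meet x y) * g (meet x y)) * (f (join x y) * g (join x y))"
    if xy: "x \<in> cube k" "y \<in> cube k" for x y
  proof -
    have "(f x * f y) * (g x * g y) \<le> (f (meet x y) * f (join x y)) * (g (meet x y) * g (join x y))"
      using * xy by (simp add: mult_mono mem_LSM mem_Bk meet_in_cube join_in_cube)
    then show ?thesis by (simp add: mult_ac)
  qed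
  with * show "(k, pointwise_mult k f g) \<in> LSM"
    by (simp add: mem_LSM Bk_mult) (simp add: pointwise_mult_def meet_in_cube join_in_cube)
next
  fix k f i assume *: "(Suc k, f) \<in> LSM" "i \<le> k"
  have le: "f (insert_arg i a x) * f (insert_arg i b y)
      \<le> f (insert_arg i (a \<and> b) (meet x y)) * f (insert_arg i (a \<or> b) (join x y))"
    if "x \<in> cube k" "y \<in> cube k" for a b x y
    using * that by (simp add: mem_LSM insert_arg_in_cube flip: meet_insert_arg join_insert_arg)
  have nonneg: "0 \<le> f (insert_arg i b x)" if "x \<in> cube k" for b x
    using * that by (auto simp: mem_LSM mem_Bk insert_arg_in_cube)
  \<comment> \<open>The four functions are the values of \<open>f\<close> over \<open>x\<close>,
    \<open>y\<close>, their meet and their join, indexed by the summed entry.\<close>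
  have "(f (insert_arg i False x) + f (insert_arg i True x)) *
      (f (insert_arg i False y) + f (insert_arg i True y)) \<le>
    (f (insert_arg i False (meet x y)) + f (insert_arg i True (meet x y))) *
      (f (insert_arg i False (join x y)) + f (insert_arg i True (join x y)))"
    if xy: "x \<in> cube k" "y \<in> cube k" for x y
    using le[OF xy, of False False] le[OF xy, of False True]
      le[OF xy, of True False] le[OF xy, of True True] xy
    by (intro four_functions nonneg meet_in_cube join_in_cube) simp_all
  with * show "(k, sum_out k i f) \<in> LSM"
    by (simp add: mem_LSM Bk_sum) (simp add: sum_out_def UNIV_bool meet_in_cube join_in_cube)
next
  fix k f h
  assume f: "(k, f) \<in> Bk k" and h: "\<And>n. (k, h n) \<in> LSM"
    and lim: "\<And>x. x \<in> cube k \<Longrightarrow> (\<lambda>n. h n x) \<longlonglongrightarrow> f x"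
  have "f x * f y \<le> f (meet x y) * f (join x y)" if "x \<in> cube k" "y \<in> cube k" for x y
  proof (rule LIMSEQ_le)
    show "(\<lambda>n. h n x * h n y) \<longlonglongrightarrow> f x * f y"
      "(\<lambda>n. h n (meet x y) * h n (join x y)) \<longlonglongrightarrow> f (meet x y) * f (join x y)"
      using that by (auto intro!: tendsto_mult lim meet_in_cube join_in_cube)
  qed (use h that in \<open>auto simp: mem_LSM\<close>)
  with f show "(k, f) \<in> LSM"
    by (simp add: mem_LSM)
qed


section \<open>The strict inclusion\<close>

text \<open>The single point \<open>[]\<close> is fixed by complement, meet and join, and the only
  Fourier coefficient is the value there.\<close>

lemma Bk_0_subset: "Bk 0 \<subseteq> SDP \<inter> LSM"
proof
  fix p assume p: "p \<in> Bk 0"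
  then obtain f where "p = (0, f)"
    by (auto simp: Bk_def)
  with p show "p \<in> SDP \<inter> LSM"
    by (simp add: mem_SDP mem_LSM fourier_nonneg_0 compl_def) (simp add: mem_Bk)
qed

lemma H_ferro_subset: "H_ferro \<subseteq> SDP \<inter> LSM"
proof -
  have "{Ising k l | k l. 2 \<le> k \<and> 0 \<le> l \<and> l \<le> 1} \<union> Bk 0 \<subseteq> SDP \<inter> LSM"
    using Bk_0_subset Ising_mem_SDP Ising_mem_LSM by auto
  then show ?thesis
    unfolding H_ferro_def
    using SDP.omega_clone_subset LSM.omega_clone_subset by simp
qed

section \<open>The separating function\<close>

definition even_parity :: "nat \<Rightarrow> bfun" where
  "even_parity k = (k, \<lambda>x\<in>cube k. of_bool (even (weight x)))"

lemma even_parity_mem_SDP: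
  assumes "even k"
  shows "even_parity k \<in> SDP"
proof -
  define g where "g = (\<lambda>x\<in>cube k. of_bool (even (weight x)) :: real)"
  have "(k, g) \<in> Bk k"
    by (simp add: mem_Bk g_def)
  \<comment> \<open>The weights of a point and its complement add up to \<open>k\<close>, which is
    even.\<close>
  moreover have "even (weight (compl x)) \<longleftrightarrow> even (weight x)" if "x \<in> cube k" for x
    using weight_compl[of x] assms length_cube[OF that] by (metis even_add)
  \<comment> \<open>The indicator of even weight is the average of the constant 1 and the parity
    character.\<close>
  moreover have "fourier_nonneg k (\<lambda>x. (1/2) * (1 + (-1) ^ weight x))"
    by (intro fourier_nonneg_scale fourier_nonneg_add fourier_nonneg_const fourier_nonneg_parity) auto
  then have "fourier_nonneg k g"
    by (rule iffD1[OF fourier_nonneg_cong, rotated]) (simp add: g_def minus_one_power_iff)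
  ultimately show ?thesis
    by (simp add: even_parity_def mem_SDP flip: g_def) (simp add: g_def)
qed

lemma even_parity_4_not_LSM: "even_parity 4 \<notin> LSM"
proof
  \<comment> \<open>Both points have weight 2, but their meet has weight 1 and their join weight 3,
    so the inequality would read \<open>1 \<le> 0\<close>.\<close>
  let ?x = "[True, True, False, False]" and ?y = "[True, False, True, False]"
  assume "even_parity 4 \<in> LSM"
  moreover have "?x \<in> cube 4" "?y \<in> cube 4" "meet ?x ?y \<in> cube 4" "join ?x ?y \<in> cube 4"
    by (simp_all add: cube_def)
  ultimately show False
    unfolding even_parity_def mem_LSM by fastforce
qed

theorem theorem7p8:
  shows "H_ferro \<subset> SDP"
  using H_ferro_subset even_parity_mem_SDP[of 4] even_parity_4_not_LSM by auto

end
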